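(* Let $(A,\mu,\alpha)$ be a multiplicative Hom-alternative algebra over $\mathbf{k}$. Let $[x,y]=\mu(x,y)-\mu(y,x)$ be the commutator bracket of $\mu$ and $as_A$ the Hom-associator of $A$. For $k\ge 0$ define the $(2^{k+1}+1)$-ary product $[,\ldots,]^{(k)}$ on $A$ inductively by setting $$[x_1,x_2,x_3]^{(0)} = \frac{1}{2}[[x_1,x_2],\alpha(x_3)] - as_A(x_1,x_2,x_3)$$ and $$[x_1,\ldots,x_{2^{k+1}+1}]^{(k)} = \big[[x_1,\ldots,x_{2^k+1}]^{(k-1)},\alpha^{2^k}(x_{2^k+2}),\ldots,\alpha^{2^k}(x_{2^{k+1}+1})\big]^{(k-1)}$$ for $k\ge 1$ and $x_i\in A$. Then $$A_L^{+k} = (A,[,\ldots,]^{(k)},\alpha^{2^{k+1}})$$ is a multiplicative $(2^{k+1}+1)$-ary Hom-Nambu algebra for each $k\ge 0$.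
   Context: $\mathbf{k}$ is a fixed field of characteristic $0$; $\alpha^m$ denotes $m$-fold composition. A multiplicative Hom-algebra $(A,\mu,\alpha)$ is a $\mathbf{k}$-module $A$ with a bilinear map $\mu\colon A\otimes A\to A$ (no associativity assumed), written $xy=\mu(x,y)$, and a linear map $\alpha\colon A\to A$ such that $\alpha(xy)=\alpha(x)\alpha(y)$. Its Hom-associator is $as_A(x,y,z) = (xy)\alpha(z) - \alpha(x)(yz)$. A Hom-alternative algebra is a Hom-algebra whose Hom-associator is anti-symmetric in its three arguments (permuting the arguments by $\sigma$ multiplies $as_A$ by the sign of $\sigma$). For $n\ge 2$, an $n$-ary Hom-algebra $(V,[,\ldots,],(\alpha_1,\ldots,\alpha_{n-1}))$ is a $\mathbf{k}$-module $V$ with an $n$-linear map $[,\ldots,]\colon V^{\otimes n}\to V$ and linear maps $\alpha_1,\ldots,\alpha_{n-1}\colon V\to V$ (the twisting maps). If all twisting maps equal one map $\gamma$ it is written $(V,[,\ldots,],\gamma)$; it is multiplicative if moreover $\gamma([x_1,\ldots,x_n])=[\gamma(x_1),\ldots,\gamma(x_n)]$. It is an $n$-ary Hom-Nambu algebra if for all $x_1,\ldots,x_{n-1},y_1,\ldots,y_n\in V$, $$[\alpha_1(x_1),\ldots,\alpha_{n-1}(x_{n-1}),[y_1,\ldots,y_n]] = \sum_{i=1}^n [\alpha_1(y_1),\ldots,\alpha_{i-1}(y_{i-1}),[x_1,\ldots,x_{n-1},y_i],\alpha_i(y_{i+1}),\ldots,\alpha_{n-1}(y_n)].$$ *)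

theory Defs
  imports Complex_Main "HOL-Combinatorics.Permutations"
begin

locale multiplicative_hom_algebra = vector_space scale
  for scale :: "'k::field \<Rightarrow> 'a::ab_group_add \<Rightarrow> 'a" +
  fixes \<mu> :: "'a \<Rightarrow> 'a \<Rightarrow> 'a" and \<alpha> :: "'a \<Rightarrow> 'a"
  assumes linear_left: "Vector_Spaces.linear scale scale (\<lambda>x. \<mu> x y)"
    and linear_right: "Vector_Spaces.linear scale scale (\<lambda>y. \<mu> x y)"
    and linear_twist: "Vector_Spaces.linear scale scale \<alpha>"
    and twist_mult: "\<alpha> (\<mu> x y) = \<mu> (\<alpha> x) (\<alpha> y)"

definition hom_associator ::
  "('a \<Rightarrow> 'a \<Rightarrow> 'a) \<Rightarrow> ('a \<Rightarrow> 'a) \<Rightarrow> 'a \<Rightarrow> 'a \<Rightarrow> 'a \<Rightarrow> 'a::ab_group_add" where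
  "hom_associator \<mu> \<alpha> x y z = \<mu> (\<mu> x y) (\<alpha> z) - \<mu> (\<alpha> x) (\<mu> y z)"

definition commutator :: "('a \<Rightarrow> 'a \<Rightarrow> 'a) \<Rightarrow> 'a \<Rightarrow> 'a \<Rightarrow> 'a::ab_group_add" where
  "commutator \<mu> x y = \<mu> x y - \<mu> y x"

locale multiplicative_hom_alternative_algebra = multiplicative_hom_algebra +
  assumes hom_associator_antisym:
    "\<sigma> permutes {..<3} \<Longrightarrow>
      hom_associator \<mu> \<alpha> (x (\<sigma> 0)) (x (\<sigma> 1)) (x (\<sigma> 2)) =
      scale (of_int (sign \<sigma>)) (hom_associator \<mu> \<alpha> (x 0) (x 1) (x (2::nat)))"

text \<open>An n-ary product is a function on lists, of which only the values on lists of
  length n are relevant; arguments and twisting maps are numbered from 0.\<close>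

locale nary_hom_algebra = vector_space scale
  for scale :: "'k::field \<Rightarrow> 'a::ab_group_add \<Rightarrow> 'a" +
  fixes n :: nat and br :: "'a list \<Rightarrow> 'a" and \<alpha>s :: "('a \<Rightarrow> 'a) list"
  assumes arity: "2 \<le> n"
    and nlinear: "length xs = n \<Longrightarrow> i < n \<Longrightarrow>
      Vector_Spaces.linear scale scale (\<lambda>v. br (xs[i := v]))"
    and length_twists: "length \<alpha>s = n - 1"
    and linear_twists: "\<gamma> \<in> set \<alpha>s \<Longrightarrow> Vector_Spaces.linear scale scale \<gamma>"

definition apply_twists :: "('a \<Rightarrow> 'a) list \<Rightarrow> 'a list \<Rightarrow> 'a list" where
  "apply_twists \<alpha>s xs = map2 (\<lambda>f x. f x) \<alpha>s xs"

text \<open>In the i-th summand below, the argument following the inner bracket is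
  twisted by the map at position i of the list, so no twisting map is skipped.\<close>

locale nary_hom_nambu_algebra = nary_hom_algebra +
  assumes hom_nambu_identity: "length xs = n - 1 \<Longrightarrow> length ys = n \<Longrightarrow>
    br (apply_twists \<alpha>s xs @ [br ys]) =
    (\<Sum>i<n. br (apply_twists (take i \<alpha>s) (take i ys) @ [br (xs @ [ys ! i])] @
              apply_twists (drop i \<alpha>s) (drop (Suc i) ys)))"

locale multiplicative_nary_hom_nambu_algebra =
  nary_hom_nambu_algebra scale n br "replicate (n - 1) \<gamma>"
  for scale :: "'k::field \<Rightarrow> 'a::ab_group_add \<Rightarrow> 'a" and n br and \<gamma> :: "'a \<Rightarrow> 'a" +
  assumes twist_br: "length xs = n \<Longrightarrow> \<gamma> (br xs) = br (map \<gamma> xs)"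

primrec higher_bracket ::
  "('k::field \<Rightarrow> 'a \<Rightarrow> 'a) \<Rightarrow> ('a \<Rightarrow> 'a \<Rightarrow> 'a) \<Rightarrow> ('a \<Rightarrow> 'a) \<Rightarrow> nat \<Rightarrow> 'a list \<Rightarrow> 'a::ab_group_add" where
  "higher_bracket scale \<mu> \<alpha> 0 xs =
    scale (1 / 2) (commutator \<mu> (commutator \<mu> (xs ! 0) (xs ! 1)) (\<alpha> (xs ! 2)))
    - hom_associator \<mu> \<alpha> (xs ! 0) (xs ! 1) (xs ! 2)"
| "higher_bracket scale \<mu> \<alpha> (Suc k) xs =
    higher_bracket scale \<mu> \<alpha> k
      (higher_bracket scale \<mu> \<alpha> k (take (2 ^ Suc k + 1) xs)
        # map (\<alpha> ^^ (2 ^ Suc k)) (drop (2 ^ Suc k + 1) xs))"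

end

theory Submission
  imports Defs
begin

text \<open>
  A Hom-alternative algebra obeys the classical laws of alternative algebras once twisting
  maps are inserted: in a homogeneous identity of degree \<open>m\<close>, a variable that sits at depth \<open>d\<close> of
  a product tree carries \<open>\<alpha>\<^sup>m\<^sup>-\<^sup>1\<^sup>-\<^sup>d\<close>, and because \<open>\<alpha>\<close> is multiplicative this placement is
  preserved by substitution. So the classical route is open.

  Twice the ternary bracket is \<open>triple x y z = [[x,y],\<alpha>(z)] - 2 as(x,y,z)\<close>. Call
  \<open>inner_der x y z = [[x,y],\<alpha>(z)] - 3 as(x,y,z)\<close>. Two facts, both of degree four, hold.
  The operator \<open>inner_der x y\<close> is a derivation of the product (\<open>inner_der_mult\<close>), hence of
  everything built from the product, in particular of \<open>triple\<close>. The operator \<open>[c,\<sqdot>]\<close>, which in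
  general is not a derivation of the product, is a derivation of \<open>triple\<close> (\<open>ad_triple\<close>). As
  \<open>3 triple x y = 2 inner_der x y + [[x,y],\<sqdot>]\<close>, the operator \<open>triple x y\<close> is a derivation of
  \<open>triple\<close>, which is the ternary Hom-Nambu identity. Both degree-four facts follow from one
  formula, \<open>thrice_as_mult\<close>, which expresses \<open>as(wx,\<alpha>(y),\<alpha>(z))\<close> by products of an
  element and an associator: the Hom-form of Kleinfeld's computation.

  The step from \<open>k\<close> to \<open>k + 1\<close> holds for all Hom-Nambu algebras
  (\<open>multiplicative_nary_hom_nambu_algebra_double\<close>): composing an \<open>n\<close>-ary bracket with itself in the
  first slot gives a \<open>(2n-1)\<close>-ary bracket, whose left multiplications are again left
  multiplications of the \<open>n\<close>-ary bracket, preceded by a twist, and therefore are derivations of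
  both of its layers.
\<close>

section \<open>Hom-algebras\<close>

context multiplicative_hom_algebra
begin

notation \<mu> (infixl "\<cdot>" 70)

abbreviation as :: "'a \<Rightarrow> 'a \<Rightarrow> 'a \<Rightarrow> 'a"
  where "as \<equiv> hom_associator (\<cdot>) \<alpha>"

abbreviation comm :: "'a \<Rightarrow> 'a \<Rightarrow> 'a" ("\<lbrakk>_, _\<rbrakk>")
  where "\<lbrakk>x, y\<rbrakk> \<equiv> commutator (\<cdot>) x y"

lemmas linear_simps =
  module_hom.add [OF Vector_Spaces.linear.axioms(3)]
  module_hom.diff [OF Vector_Spaces.linear.axioms(3)]
  module_hom.neg [OF Vector_Spaces.linear.axioms(3)]
  module_hom.scale [OF Vector_Spaces.linear.axioms(3)]
  module_hom.zero [OF Vector_Spaces.linear.axioms(3)]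

lemmas mult_simps =
  linear_simps [OF linear_left] linear_simps [OF linear_right] linear_simps [OF linear_twist]
  twist_mult

lemma twist_as: "\<alpha> (as x y z) = as (\<alpha> x) (\<alpha> y) (\<alpha> z)"
  by (simp add: hom_associator_def mult_simps)

lemma twist_comm: "\<alpha> \<lbrakk>x, y\<rbrakk> = \<lbrakk>\<alpha> x, \<alpha> y\<rbrakk>"
  by (simp add: commutator_def mult_simps)

lemma comm_simps:
  "\<lbrakk>x + y, z\<rbrakk> = \<lbrakk>x, z\<rbrakk> + \<lbrakk>y, z\<rbrakk>" "\<lbrakk>z, x + y\<rbrakk> = \<lbrakk>z, x\<rbrakk> + \<lbrakk>z, y\<rbrakk>"
  "\<lbrakk>x - y, z\<rbrakk> = \<lbrakk>x, z\<rbrakk> - \<lbrakk>y, z\<rbrakk>" "\<lbrakk>z, x - y\<rbrakk> = \<lbrakk>z, x\<rbrakk> - \<lbrakk>z, y\<rbrakk>"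
  "\<lbrakk>- x, z\<rbrakk> = - \<lbrakk>x, z\<rbrakk>" "\<lbrakk>z, - x\<rbrakk> = - \<lbrakk>z, x\<rbrakk>"
  "\<lbrakk>scale r x, z\<rbrakk> = scale r \<lbrakk>x, z\<rbrakk>" "\<lbrakk>z, scale r x\<rbrakk> = scale r \<lbrakk>z, x\<rbrakk>"
  by (simp_all add: commutator_def mult_simps scale_right_diff_distrib)

lemma as_simps:
  "as (x + y) u v = as x u v + as y u v" "as u (x + y) v = as u x v + as u y v"
  "as u v (x + y) = as u v x + as u v y"
  "as (x - y) u v = as x u v - as y u v" "as u (x - y) v = as u x v - as u y v"
  "as u v (x - y) = as u v x - as u v y"
  "as (- x) u v = - as x u v" "as u (- x) v = - as u x v"
  "as u v (- x) = - as u v x"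
  "as (scale r x) u v = scale r (as x u v)" "as u (scale r x) v = scale r (as u x v)"
  "as u v (scale r x) = scale r (as u v x)"
  by (simp_all add: hom_associator_def mult_simps scale_right_diff_distrib)

lemma comm_flip: "\<lbrakk>y, x\<rbrakk> = - \<lbrakk>x, y\<rbrakk>"
  by (simp add: commutator_def)

text \<open>The Teichmueller identity: on expansion, the ten products of degree four cancel in pairs,
  as \<open>\<alpha>\<close> is linear and multiplicative.\<close>

lemma hom_teichmueller:
  "as (w \<cdot> x) (\<alpha> y) (\<alpha> z) - as (\<alpha> w) (x \<cdot> y) (\<alpha> z) + as (\<alpha> w) (\<alpha> x) (y \<cdot> z)
    = \<alpha> (\<alpha> w) \<cdot> as x y z + as w x y \<cdot> \<alpha> (\<alpha> z)"
  by (simp add: hom_associator_def mult_simps)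

end

section \<open>The associator of a Hom-alternative algebra\<close>

text \<open>Integer multiples are written as repeated sums below, so that normalisation in abelian
  groups decides every identity between linear combinations.\<close>

locale hom_alternative_char_0 = multiplicative_hom_alternative_algebra scale \<mu> \<alpha>
  for scale :: "'k::field_char_0 \<Rightarrow> 'a::ab_group_add \<Rightarrow> 'a" and \<mu> \<alpha>
begin

notation \<mu> (infixl "\<cdot>" 70)

lemma thrice_cancel: "v + v + v = w + w + w \<Longrightarrow> v = (w :: 'a)"
proof -
  have "u + u + u = scale 3 u" for u
    using scale_left_distrib[of 1 1 u] scale_left_distrib[of 2 1 u] by simp
  then show "v + v + v = w + w + w \<Longrightarrow> v = w" by simp
qed

lemma as_swap12: "- as x y z = as y x z"
proof -
  have "transpose 0 1 permutes {..<3::nat}" by (rule permutes_swap_id) auto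
  from hom_associator_antisym[OF this, of "(!) [x, y, z]"]
  show ?thesis by (simp add: sign_swap_id transpose_def)
qed

lemma as_swap23: "- as x y z = as x z y"
proof -
  have "transpose 1 2 permutes {..<3::nat}" by (rule permutes_swap_id) auto
  from hom_associator_antisym[OF this, of "(!) [x, y, z]"]
  show ?thesis by (simp add: sign_swap_id transpose_def)
qed

text \<open>Instances at chosen arguments, read from right to left, rewrite associators to those with
  the arguments in the chosen order. The variables occur first in that order, so that positional
  instantiation names it.\<close>

lemma as_perm:
  "- as x y z = as x z y" "- as x y z = as y x z" "as x y z = as y z x"
  "as x y z = as z x y" "- as x y z = as z y x"
  by (simp_all add: as_swap12[of x y z, symmetric] as_swap23[of x y z, symmetric]
      as_swap23[of y x z, symmetric] as_swap12[of x z y, symmetric] as_swap23[of z x y, symmetric])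

text \<open>Kleinfeld's argument. Let \<open>f(w,x,y,z)\<close> be the failure of \<open>as(wx,\<alpha>(y),\<alpha>(z))\<close> to obey the
  Leibniz rule in \<open>wx\<close> with the factors of each summand in reversed order. The Teichmueller
  identity says that an alternating cyclic sum of three values of \<open>f\<close> is an expression \<open>K\<close> in
  commutators, and \<open>K\<close> changes sign under the odd cyclic shift. Adding two shifted copies telescopes and shows that \<open>f\<close> changes sign too; then the cyclic
  sum is \<open>3f\<close>.\<close>

lemma thrice_as_mult:
  fixes w x y z
  defines "H \<equiv> \<lbrakk>\<alpha> (\<alpha> w), as x y z\<rbrakk> - \<lbrakk>\<alpha> (\<alpha> x), as w y z\<rbrakk> + \<lbrakk>\<alpha> (\<alpha> y), as w x z\<rbrakk>
             - \<lbrakk>\<alpha> (\<alpha> z), as w x y\<rbrakk>"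
    and "v \<equiv> \<alpha> (\<alpha> x) \<cdot> as w y z + as x y z \<cdot> \<alpha> (\<alpha> w)"
    and "p \<equiv> as (w \<cdot> x) (\<alpha> y) (\<alpha> z)"
  shows "p + p + p = H + (v + v + v)"
proof -
  define f where "f w x y z = as (w \<cdot> x) (\<alpha> y) (\<alpha> z)
     - \<alpha> (\<alpha> x) \<cdot> as w y z - as x y z \<cdot> \<alpha> (\<alpha> w)" for w x y z
  define K where "K w x y z = \<lbrakk>\<alpha> (\<alpha> w), as x y z\<rbrakk> - \<lbrakk>\<alpha> (\<alpha> x), as w y z\<rbrakk>
     + \<lbrakk>\<alpha> (\<alpha> y), as w x z\<rbrakk> - \<lbrakk>\<alpha> (\<alpha> z), as w x y\<rbrakk>" for w x y z
  have G: "f w x y z - f x y z w + f y z w x = K w x y z" for w x y z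
    using hom_teichmueller[of w x y z]
    unfolding f_def K_def commutator_def
    by (simp add: as_perm[of w x y, symmetric] as_perm[of w x z, symmetric]
        as_perm[of w y z, symmetric] as_perm[of x y z, symmetric]
        as_perm(1-3)[of "x \<cdot> y" "\<alpha> w" "\<alpha> z", symmetric]
        as_perm(3,4)[of "y \<cdot> z" "\<alpha> w" "\<alpha> x", symmetric]
        mult_simps algebra_simps)
  have K: "K x y z w = - K w x y z" for w x y z
    unfolding K_def
    by (simp add: as_perm[of w x y, symmetric] as_perm[of w x z, symmetric]
        as_perm[of w y z, symmetric] as_perm[of x y z, symmetric] comm_simps)
  have shift: "f x y z w = - f w x y z" for w x y z
  proof -
    have "f x y z w + f w x y z
        = (f x y z w - f y z w x + f z w x y) + (f y z w x - f z w x y + f w x y z)"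
      by simp
    also have "\<dots> = K x y z w + K y z w x" by (simp only: G)
    also have "\<dots> = 0" by (simp add: K[of y z w x])
    finally show ?thesis by (simp add: eq_neg_iff_add_eq_0)
  qed
  have "f w x y z + f w x y z + f w x y z = K w x y z"
    using G[of w x y z] shift[of x y z w] shift[of y z w x] by simp
  then show ?thesis
    unfolding f_def K_def H_def v_def p_def by (simp add: algebra_simps)
qed

text \<open>The antisymmetrisation of \<open>thrice_as_mult\<close> in its first two arguments: the products
  of an element and an associator combine to commutators.\<close>

lemma thrice_as_comm:
  fixes p q r s
  defines "v \<equiv> as \<lbrakk>p, q\<rbrakk> (\<alpha> r) (\<alpha> s)"
    and "h \<equiv> \<lbrakk>\<alpha> (\<alpha> r), as p q s\<rbrakk> - \<lbrakk>\<alpha> (\<alpha> s), as p q r\<rbrakk>"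
  shows "v + v + v = \<lbrakk>\<alpha> (\<alpha> q), as p r s\<rbrakk> - \<lbrakk>\<alpha> (\<alpha> p), as q r s\<rbrakk> + (h + h)"
proof -
  have "v + v + v =
      as (p \<cdot> q) (\<alpha> r) (\<alpha> s) + as (p \<cdot> q) (\<alpha> r) (\<alpha> s) + as (p \<cdot> q) (\<alpha> r) (\<alpha> s)
    - (as (q \<cdot> p) (\<alpha> r) (\<alpha> s) + as (q \<cdot> p) (\<alpha> r) (\<alpha> s) + as (q \<cdot> p) (\<alpha> r) (\<alpha> s))"
    by (simp add: v_def commutator_def as_simps)
  then show ?thesis
    unfolding thrice_as_mult h_def
    by (simp add: as_perm[of p q r, symmetric] as_perm[of p q s, symmetric] comm_simps
        commutator_def mult_simps algebra_simps)
qed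

section \<open>Two families of derivations\<close>

text \<open>For \<open>\<alpha> = id\<close> this is the inner derivation \<open>[L\<^sub>x,L\<^sub>y] + [L\<^sub>x,R\<^sub>y] + [R\<^sub>x,R\<^sub>y]\<close> of an alternative
  algebra, where \<open>L\<close> and \<open>R\<close> denote left and right multiplication.\<close>

definition inner_der :: "'a \<Rightarrow> 'a \<Rightarrow> 'a \<Rightarrow> 'a"
  where "inner_der x y z = \<lbrakk>\<lbrakk>x, y\<rbrakk>, \<alpha> z\<rbrakk> - (as x y z + as x y z + as x y z)"

text \<open>The commutator with \<open>c = [x,y]\<close> fails to be a derivation by \<open>3 as(c,a,b)\<close>. This defect
  cancels against the associator part because of
  \<open>as(ab,\<alpha>(x),\<alpha>(y)) + as([x,y],\<alpha>(a),\<alpha>(b)) = \<alpha>\<^sup>2(a) as(x,y,b) + as(x,y,a) \<alpha>\<^sup>2(b)\<close>, the equation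
  \<open>e = r\<close> below.\<close>

lemma inner_der_mult:
  "inner_der (\<alpha> x) (\<alpha> y) (a \<cdot> b) =
     inner_der x y a \<cdot> \<alpha> (\<alpha> b) + \<alpha> (\<alpha> a) \<cdot> inner_der x y b"
proof -
  have 1: "\<lbrakk>\<alpha> c, a \<cdot> b\<rbrakk> = \<lbrakk>c, a\<rbrakk> \<cdot> \<alpha> b + \<alpha> a \<cdot> \<lbrakk>c, b\<rbrakk> - (as c a b + as c a b + as c a b)"
    for a b c
  proof -
    have "\<lbrakk>\<alpha> c, a \<cdot> b\<rbrakk> = \<lbrakk>c, a\<rbrakk> \<cdot> \<alpha> b + \<alpha> a \<cdot> \<lbrakk>c, b\<rbrakk> - (as c a b - as a c b + as a b c)"
      by (simp add: commutator_def hom_associator_def mult_simps algebra_simps)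
    then show ?thesis by (simp add: as_perm[of c a b, symmetric])
  qed
  define e where "e = as (a \<cdot> b) (\<alpha> x) (\<alpha> y) + as \<lbrakk>x, y\<rbrakk> (\<alpha> a) (\<alpha> b)"
  define r where "r = \<alpha> (\<alpha> a) \<cdot> as x y b + as x y a \<cdot> \<alpha> (\<alpha> b)"
  have "e + e + e = r + r + r"
  proof -
    have "e + e + e =
      (as (a \<cdot> b) (\<alpha> x) (\<alpha> y) + as (a \<cdot> b) (\<alpha> x) (\<alpha> y) + as (a \<cdot> b) (\<alpha> x) (\<alpha> y)) +
      (as \<lbrakk>x, y\<rbrakk> (\<alpha> a) (\<alpha> b) + as \<lbrakk>x, y\<rbrakk> (\<alpha> a) (\<alpha> b) + as \<lbrakk>x, y\<rbrakk> (\<alpha> a) (\<alpha> b))"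
      by (simp add: e_def algebra_simps)
    also have "\<dots> = r + r + r"
      unfolding thrice_as_mult thrice_as_comm
      by (simp add: r_def as_perm[of a b x, symmetric] as_perm[of a b y, symmetric]
        as_perm[of a x y, symmetric] as_perm[of b x y, symmetric] comm_simps
        commutator_def mult_simps algebra_simps)
    finally show ?thesis .
  qed
  then have "e = r" by (rule thrice_cancel)
  then have 2: "as (\<alpha> x) (\<alpha> y) (a \<cdot> b) = r - as \<lbrakk>x, y\<rbrakk> (\<alpha> a) (\<alpha> b)"
    by (simp add: e_def as_perm(3)[of "a \<cdot> b" "\<alpha> x" "\<alpha> y"] algebra_simps)
  show ?thesis
    by (simp add: inner_der_def twist_comm[symmetric] twist_mult 1 2 r_def)
      (simp add: mult_simps algebra_simps)
qed

text \<open>For \<open>\<alpha> = id\<close> three times this is Loos's Lie triple product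
  \<open>2[[x,y],z] - [[y,z],x] - [[z,x],y]\<close> of the Malcev algebra of commutators.\<close>

definition triple :: "'a \<Rightarrow> 'a \<Rightarrow> 'a \<Rightarrow> 'a"
  where "triple x y z = \<lbrakk>\<lbrakk>x, y\<rbrakk>, \<alpha> z\<rbrakk> - (as x y z + as x y z)"

text \<open>The Hom-Jacobian of the commutator is six times the associator (\<open>leibniz\<close>). So the defect
  of \<open>[c,\<sqdot>]\<close> on \<open>triple\<close> is a combination of associators with one commutator inside or
  outside. By \<open>thrice_as_comm\<close> those with the commutator inside reduce to the others,
  which then cancel.\<close>

lemma ad_triple:
  "\<lbrakk>\<alpha> (\<alpha> c), triple a b y\<rbrakk> =
     triple \<lbrakk>c, a\<rbrakk> (\<alpha> b) (\<alpha> y) + triple (\<alpha> a) \<lbrakk>c, b\<rbrakk> (\<alpha> y) + triple (\<alpha> a) (\<alpha> b) \<lbrakk>c, y\<rbrakk>"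
proof -
  have leibniz: "\<lbrakk>\<alpha> c, \<lbrakk>u, v\<rbrakk>\<rbrakk> = \<lbrakk>\<lbrakk>c, u\<rbrakk>, \<alpha> v\<rbrakk> + \<lbrakk>\<alpha> u, \<lbrakk>c, v\<rbrakk>\<rbrakk>
      - (as c u v + as c u v + as c u v + as c u v + as c u v + as c u v)" for c u v
  proof -
    have "\<lbrakk>\<alpha> c, \<lbrakk>u, v\<rbrakk>\<rbrakk> = \<lbrakk>\<lbrakk>c, u\<rbrakk>, \<alpha> v\<rbrakk> + \<lbrakk>\<alpha> u, \<lbrakk>c, v\<rbrakk>\<rbrakk>
      - (as c u v - as c v u - as u c v + as u v c + as v c u - as v u c)"
      by (simp add: commutator_def hom_associator_def mult_simps algebra_simps)
    then show ?thesis by (simp add: as_perm[of c u v, symmetric])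
  qed
  define d where "d = \<lbrakk>\<alpha> (\<alpha> c), as a b y\<rbrakk>"
  define e where "e = \<lbrakk>as c a b, \<alpha> (\<alpha> y)\<rbrakk>"
  define m where "m = as \<lbrakk>a, b\<rbrakk> (\<alpha> c) (\<alpha> y)"
  define p where "p = as \<lbrakk>c, a\<rbrakk> (\<alpha> b) (\<alpha> y)"
  define q where "q = as \<lbrakk>c, b\<rbrakk> (\<alpha> a) (\<alpha> y)"
  define r where "r = as \<lbrakk>c, y\<rbrakk> (\<alpha> a) (\<alpha> b)"
  have "(p - q + r + m + m + m) + (p - q + r + m + m + m) + (p - q + r + m + m + m)
    = (p + p + p) - (q + q + q) + (r + r + r)
      + ((m + m + m) + (m + m + m) + (m + m + m))"
    by (simp add: algebra_simps)
  also have "\<dots> = (d + e + e + e) + (d + e + e + e) + (d + e + e + e)"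
    unfolding p_def q_def r_def m_def thrice_as_comm
    by (simp add: d_def e_def as_perm[of c a b, symmetric] as_perm[of c a y, symmetric]
        as_perm[of c b y, symmetric] as_perm[of a b y, symmetric] comm_simps
        comm_flip[of "\<alpha> (\<alpha> y)"] algebra_simps)
  finally have "p - q + r + m + m + m = d + e + e + e"
    by (rule thrice_cancel)
  then have d: "d = p - q + r + m + m + m - e - e - e"
    by (simp add: algebra_simps)
  have flip: "as (\<alpha> c) \<lbrakk>a, b\<rbrakk> (\<alpha> y) = - m" "as (\<alpha> a) \<lbrakk>c, b\<rbrakk> (\<alpha> y) = - q"
    "as (\<alpha> a) (\<alpha> b) \<lbrakk>c, y\<rbrakk> = r"
    by (simp_all add: m_def q_def r_def as_perm(2)[of "\<lbrakk>a, b\<rbrakk>", symmetric]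
        as_perm(2)[of "\<lbrakk>c, b\<rbrakk>", symmetric] as_perm(3)[of "\<lbrakk>c, y\<rbrakk>", symmetric])
  have "\<lbrakk>\<alpha> (\<alpha> c), \<lbrakk>\<lbrakk>a, b\<rbrakk>, \<alpha> y\<rbrakk>\<rbrakk> =
    \<lbrakk>\<lbrakk>\<lbrakk>c, a\<rbrakk>, \<alpha> b\<rbrakk>, \<alpha> (\<alpha> y)\<rbrakk> + \<lbrakk>\<lbrakk>\<alpha> a, \<lbrakk>c, b\<rbrakk>\<rbrakk>, \<alpha> (\<alpha> y)\<rbrakk> - (e + e + e + e + e + e)
    + \<lbrakk>\<lbrakk>\<alpha> a, \<alpha> b\<rbrakk>, \<alpha> \<lbrakk>c, y\<rbrakk>\<rbrakk> + (m + m + m + m + m + m)"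
    by (simp add: leibniz[of "\<alpha> c" "\<lbrakk>a, b\<rbrakk>" "\<alpha> y"] leibniz[of c a b] comm_simps flip e_def
        twist_comm)
  then show ?thesis
    unfolding triple_def comm_simps flip p_def[symmetric] d_def[symmetric] d
    by (simp add: algebra_simps)
qed

lemma inner_der_triple:
  "inner_der (\<alpha> (\<alpha> x)) (\<alpha> (\<alpha> y)) (triple a b c) =
     triple (inner_der x y a) (\<alpha> (\<alpha> b)) (\<alpha> (\<alpha> c)) + triple (\<alpha> (\<alpha> a)) (inner_der x y b) (\<alpha> (\<alpha> c))
     + triple (\<alpha> (\<alpha> a)) (\<alpha> (\<alpha> b)) (inner_der x y c)"
proof -
  have inner_der_simps: "inner_der x y (u + v) = inner_der x y u + inner_der x y v"
    "inner_der x y (u - v) = inner_der x y u - inner_der x y v" for x y u v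
    by (simp_all add: inner_der_def as_simps comm_simps mult_simps algebra_simps)
  have twist_inner_der: "inner_der (\<alpha> x) (\<alpha> y) (\<alpha> z) = \<alpha> (inner_der x y z)" for x y z
    by (simp add: inner_der_def twist_as twist_comm mult_simps)
  show ?thesis
    unfolding triple_def commutator_def hom_associator_def
    by (simp add: inner_der_simps twist_inner_der inner_der_mult mult_simps algebra_simps)
qed

section \<open>The ternary bracket\<close>

lemma triple_linear:
  "Vector_Spaces.linear scale scale (\<lambda>x. triple x y z)"
  "Vector_Spaces.linear scale scale (\<lambda>y. triple x y z)"
  "Vector_Spaces.linear scale scale (\<lambda>z. triple x y z)"
  by (unfold_locales;
      simp add: triple_def as_simps comm_simps mult_simps scale_right_diff_distrib
        scale_right_distrib)+

lemmas triple_simps = triple_linear [THEN linear_simps(1)] triple_linear [THEN linear_simps(4)]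

lemma thrice_triple:
  "triple x y z + triple x y z + triple x y z =
     inner_der x y z + inner_der x y z + \<lbrakk>\<lbrakk>x, y\<rbrakk>, \<alpha> z\<rbrakk>"
  by (simp add: triple_def inner_der_def algebra_simps)

lemma twist_triple: "\<alpha> (triple x y z) = triple (\<alpha> x) (\<alpha> y) (\<alpha> z)"
  by (simp add: triple_def mult_simps twist_as twist_comm)

text \<open>Tripled, each inner \<open>triple x y\<close> splits into two inner derivations and a commutator,
  and each of these satisfies the Leibniz rule.\<close>

lemma triple_nambu:
  "triple (\<alpha> (\<alpha> x)) (\<alpha> (\<alpha> y)) (triple a b c) =
     triple (triple x y a) (\<alpha> (\<alpha> b)) (\<alpha> (\<alpha> c)) + triple (\<alpha> (\<alpha> a)) (triple x y b) (\<alpha> (\<alpha> c))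
     + triple (\<alpha> (\<alpha> a)) (\<alpha> (\<alpha> b)) (triple x y c)"
proof (rule thrice_cancel, goal_cases)
  case 1
  show ?case (is "_ = ?r + ?r + ?r")
  proof -
    have "?r + ?r + ?r =
       triple (triple x y a + triple x y a + triple x y a) (\<alpha> (\<alpha> b)) (\<alpha> (\<alpha> c))
       + triple (\<alpha> (\<alpha> a)) (triple x y b + triple x y b + triple x y b) (\<alpha> (\<alpha> c))
       + triple (\<alpha> (\<alpha> a)) (\<alpha> (\<alpha> b)) (triple x y c + triple x y c + triple x y c)"
      by (simp add: triple_simps algebra_simps)
    also have "\<dots> = inner_der (\<alpha> (\<alpha> x)) (\<alpha> (\<alpha> y)) (triple a b c)
       + inner_der (\<alpha> (\<alpha> x)) (\<alpha> (\<alpha> y)) (triple a b c)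
       + \<lbrakk>\<alpha> (\<alpha> \<lbrakk>x, y\<rbrakk>), triple (\<alpha> a) (\<alpha> b) (\<alpha> c)\<rbrakk>"
      unfolding thrice_triple inner_der_triple ad_triple
      by (simp add: triple_simps algebra_simps)
    finally show ?thesis unfolding thrice_triple twist_triple twist_comm by simp
  qed
qed

lemma higher_bracket_0: "higher_bracket scale (\<cdot>) \<alpha> 0 [x, y, z] = scale (1 / 2) (triple x y z)"
proof -
  have "scale (1 / 2) v + scale (1 / 2) v = v" for v
    using scale_left_distrib[of "1 / 2" "1 / 2" v] by simp
  then show ?thesis by (simp add: triple_def scale_right_diff_distrib scale_right_distrib)
qed

end

section \<open>Composing a Hom-Nambu bracket with itself\<close>

text \<open>With equal twisting maps, the \<open>i\<close>-th summand of the Hom-Nambu identity is the bracket of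
  the twisted arguments with the entry at \<open>i\<close> replaced.\<close>

lemma multiplicative_nary_hom_nambu_algebra_iff:
  "multiplicative_nary_hom_nambu_algebra scale n br \<gamma> \<longleftrightarrow>
    vector_space scale \<and> 2 \<le> n \<and> Vector_Spaces.linear scale scale \<gamma> \<and>
    (\<forall>xs i. length xs = n \<longrightarrow> i < n \<longrightarrow> Vector_Spaces.linear scale scale (\<lambda>v. br (xs[i := v]))) \<and>
    (\<forall>xs. length xs = n \<longrightarrow> \<gamma> (br xs) = br (map \<gamma> xs)) \<and>
    (\<forall>xs ys. length xs = n - 1 \<longrightarrow> length ys = n \<longrightarrow>
      br (map \<gamma> xs @ [br ys]) = (\<Sum>i<n. br ((map \<gamma> ys)[i := br (xs @ [ys ! i])])))"
proof -
  have twists: "apply_twists (replicate m \<gamma>) zs = map \<gamma> zs" if "length zs = m" for m zs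
    using that unfolding apply_twists_def by (induction zs arbitrary: m) auto
  have "apply_twists (take i (replicate (n - 1) \<gamma>)) (take i ys) @ [z]
      @ apply_twists (drop i (replicate (n - 1) \<gamma>)) (drop (Suc i) ys) = (map \<gamma> ys)[i := z]"
    if "length ys = n" "i < n" for i ys z
    using that by (simp add: twists upd_conv_take_nth_drop take_map drop_map)
  then show ?thesis
    unfolding multiplicative_nary_hom_nambu_algebra_def nary_hom_nambu_algebra_def
      nary_hom_algebra_def nary_hom_algebra_axioms_def nary_hom_nambu_algebra_axioms_def
      multiplicative_nary_hom_nambu_algebra_axioms_def
    by (auto simp: twists)
qed

text \<open>For \<open>xs\<close> of length \<open>2n-2\<close> the new left multiplication sends \<open>z\<close> to the bracket of
  \<open>P\<close> and \<open>\<gamma>(z)\<close>, where \<open>P\<close> has length \<open>n-1\<close>. The Hom-Nambu identity for \<open>\<gamma>(P)\<close> moves it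
  into the outer bracket of the new product, and the identity for \<open>P\<close> into the inner one.\<close>

lemma multiplicative_nary_hom_nambu_algebra_double:
  assumes "multiplicative_nary_hom_nambu_algebra scale n br \<gamma>"
  shows "multiplicative_nary_hom_nambu_algebra scale (2 * n - 1)
    (\<lambda>xs. br (br (take n xs) # map \<gamma> (drop n xs))) (\<gamma> \<circ> \<gamma>)"
    (is "multiplicative_nary_hom_nambu_algebra _ _ ?br' _")
proof -
  from assms have vs: "vector_space scale" and n: "2 \<le> n"
    and lin_\<gamma>: "Vector_Spaces.linear scale scale \<gamma>"
    and lin: "\<And>xs i. length xs = n \<Longrightarrow> i < n \<Longrightarrow>
      Vector_Spaces.linear scale scale (\<lambda>v. br (xs[i := v]))"
    and twist: "\<And>xs. length xs = n \<Longrightarrow> \<gamma> (br xs) = br (map \<gamma> xs)"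
    and nambu: "\<And>xs ys. length xs = n - 1 \<Longrightarrow> length ys = n \<Longrightarrow>
      br (map \<gamma> xs @ [br ys]) = (\<Sum>i<n. br ((map \<gamma> ys)[i := br (xs @ [ys ! i])]))"
    unfolding multiplicative_nary_hom_nambu_algebra_iff by auto
  have lin_head: "Vector_Spaces.linear scale scale (\<lambda>v. br (v # zs))" if "length zs = n - 1" for zs
    using lin[of "undefined # zs" 0] that n by simp
  show ?thesis
    unfolding multiplicative_nary_hom_nambu_algebra_iff
  proof (intro conjI allI impI)
    show "vector_space scale" by fact
    show "2 \<le> 2 * n - 1" using n by simp
    show "Vector_Spaces.linear scale scale (\<gamma> \<circ> \<gamma>)"
      by (rule Vector_Spaces.linear_compose) fact+
  next
    fix xs :: "'b list" and i
    assume len: "length xs = 2 * n - 1" and i: "i < 2 * n - 1"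
    show "Vector_Spaces.linear scale scale (\<lambda>v. ?br' (xs[i := v]))"
    proof (cases "i < n")
      case True
      then show ?thesis
        using Vector_Spaces.linear_compose[OF lin[of "take n xs" i]
            lin_head[of "map \<gamma> (drop n xs)"]]
          len n by (simp add: o_def take_update_swap)
    next
      case False
      define j where "j = i - n"
      have j: "i = n + j" "Suc j < n" using i False by (auto simp: j_def)
      show ?thesis
        using Vector_Spaces.linear_compose[OF lin_\<gamma>
            lin[of "br (take n xs) # map \<gamma> (drop n xs)" "Suc j"]]
          len j by (simp add: o_def drop_update_swap map_update)
    qed
  next
    fix xs :: "'b list"
    assume len: "length xs = 2 * n - 1"
    then show "(\<gamma> \<circ> \<gamma>) (?br' xs) = ?br' (map (\<gamma> \<circ> \<gamma>) xs)"
      using n by (simp add: twist take_map drop_map o_def)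
  next
    fix xs ys :: "'b list"
    assume len: "length xs = 2 * n - 1 - 1" "length ys = 2 * n - 1"
    define P where "P = br (take n xs) # map \<gamma> (drop n xs)"
    define Y1 where "Y1 = take n ys"
    define Y2 where "Y2 = drop n ys"
    have lens: "length P = n - 1" "length Y1 = n" "length Y2 = n - 1"
      and ys: "ys = Y1 @ Y2"
      using len n by (simp_all add: P_def Y1_def Y2_def)
    have br'_snoc: "?br' (xs @ [z]) = br (P @ [\<gamma> z])" for z
      using len n by (simp add: P_def)
    have twist_P: "\<gamma> (br (P @ [z])) = br (map \<gamma> P @ [\<gamma> z])" for z
      using lens n by (simp add: twist)
    define s where "s i = ?br' ((map (\<gamma> \<circ> \<gamma>) ys)[i := ?br' (xs @ [ys ! i])])" for i
    have s_eq: "s i = ?br' ((map (\<gamma> \<circ> \<gamma>) ys)[i := br (P @ [\<gamma> (ys ! i)])])" for i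
      unfolding s_def br'_snoc ..
    \<comment> \<open>The argument of the outer bracket that is itself a bracket absorbs a second use of the
      identity and yields the first \<open>n\<close> summands; the others yield one summand each.\<close>
    have head: "br (br (map \<gamma> P @ [\<gamma> (br Y1)]) # map \<gamma> (map \<gamma> (map \<gamma> Y2))) = (\<Sum>i<n. s i)"
    proof -
      have inner: "br (map \<gamma> P @ [\<gamma> (br Y1)])
          = (\<Sum>i<n. br ((map \<gamma> (map \<gamma> Y1))[i := br (P @ [\<gamma> (Y1 ! i)])]))"
        using lens by (simp add: twist nambu)
      have "br (br (map \<gamma> P @ [\<gamma> (br Y1)]) # map \<gamma> (map \<gamma> (map \<gamma> Y2)))
          = (\<Sum>i<n. br (br ((map \<gamma> (map \<gamma> Y1))[i := br (P @ [\<gamma> (Y1 ! i)])])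
                # map \<gamma> (map \<gamma> (map \<gamma> Y2))))"
        unfolding inner using lens
        by (simp add: module_hom.sum[OF Vector_Spaces.linear.axioms(3)[OF lin_head]])
      also have "\<dots> = (\<Sum>i<n. s i)"
        using lens by (intro sum.cong)
          (auto simp: s_eq ys nth_append list_update_append o_def)
      finally show ?thesis .
    qed
    have tail: "(\<Sum>j<n - 1. br (\<gamma> (\<gamma> (br Y1)) # (map \<gamma> (map \<gamma> (map \<gamma> Y2)))
              [j := br (map \<gamma> P @ [\<gamma> (map \<gamma> Y2 ! j)])])) = (\<Sum>j<n - 1. s (n + j))"
      using lens by (intro sum.cong)
        (auto simp: s_eq ys nth_append list_update_append o_def twist_P map_update twist)
    have split: "(\<Sum>i<n. s i) + (\<Sum>j<m. s (n + j)) = (\<Sum>i<n + m. s i)" for m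
      by (induction m) (simp_all add: add.assoc[symmetric])
    have arity: "n + (n - 1) = 2 * n - 1" using n by simp
    have "?br' (map (\<gamma> \<circ> \<gamma>) xs @ [?br' ys])
        = br (map \<gamma> (map \<gamma> P) @ [br (map \<gamma> (br Y1 # map \<gamma> Y2))])"
      using len lens n
      by (simp add: P_def twist take_map drop_map o_def flip: Y1_def Y2_def)
    also have "\<dots> = (\<Sum>i<n. br ((map \<gamma> (map \<gamma> (br Y1 # map \<gamma> Y2)))
        [i := br (map \<gamma> P @ [\<gamma> ((br Y1 # map \<gamma> Y2) ! i)])]))"
      using lens n by (subst nambu) (auto simp: o_def nth_Cons split: nat.split intro!: sum.cong)
    also have "\<dots> = (\<Sum>i<n. s i) + (\<Sum>j<n - 1. s (n + j))"
      unfolding head[symmetric] tail[symmetric]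
      using n by (cases n) (simp_all add: sum.lessThan_Suc_shift del: sum.lessThan_Suc)
    finally show "?br' (map (\<gamma> \<circ> \<gamma>) xs @ [?br' ys])
        = (\<Sum>i<2 * n - 1. ?br' ((map (\<gamma> \<circ> \<gamma>) ys)[i := ?br' (xs @ [ys ! i])]))"
      unfolding split arity unfolding s_def .
  qed
qed

section \<open>The higher brackets\<close>

lemma (in hom_alternative_char_0) ternary_hom_nambu:
  "multiplicative_nary_hom_nambu_algebra scale 3 (higher_bracket scale \<mu> \<alpha> 0) (\<alpha> \<circ> \<alpha>)"
proof -
  have list3: "(\<forall>xs. length xs = 3 \<longrightarrow> P xs) \<longleftrightarrow> (\<forall>x y z. P [x, y, z])" for P :: "'a list \<Rightarrow> bool"
    by (auto simp: numeral_3_eq_3 length_Suc_conv)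
  have less3: "(\<forall>i<3. P i) \<longleftrightarrow> P 0 \<and> P 1 \<and> P 2" for P :: "nat \<Rightarrow> bool"
    by (auto simp: numeral_3_eq_3 numeral_2_eq_2 less_Suc_eq)
  show ?thesis
    unfolding multiplicative_nary_hom_nambu_algebra_iff
  proof (intro conjI, goal_cases)
    case 1
    show ?case by (rule vector_space_axioms)
  next
    case 3
    show ?case by (rule Vector_Spaces.linear_compose[OF linear_twist linear_twist])
  next
    case 4
    have "Vector_Spaces.linear scale scale (\<lambda>v. scale (1 / 2) (f v))"
      if "Vector_Spaces.linear scale scale f" for f
      using that by (simp add: Vector_Spaces.linear_iff scale_right_distrib mult.commute)
    then show ?case
      using triple_linear by (simp add: list3 less3 higher_bracket_0 del: higher_bracket.simps)
  next
    case 5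
    show ?case
      by (simp add: list3 higher_bracket_0 twist_triple mult_simps del: higher_bracket.simps)
  next
    case 6
    show ?case
    proof (intro allI impI)
      fix xs ys :: "'a list"
      assume "length xs = 3 - 1" "length ys = 3"
      then obtain x y a b c where "xs = [x, y]" "ys = [a, b, c]"
        by (auto simp: numeral_2_eq_2 numeral_3_eq_3 length_Suc_conv)
      then show "higher_bracket scale \<mu> \<alpha> 0 (map (\<alpha> \<circ> \<alpha>) xs @ [higher_bracket scale \<mu> \<alpha> 0 ys])
          = (\<Sum>i<3. higher_bracket scale \<mu> \<alpha> 0
              ((map (\<alpha> \<circ> \<alpha>) ys)[i := higher_bracket scale \<mu> \<alpha> 0 (xs @ [ys ! i])]))"
        by (simp add: higher_bracket_0 triple_simps triple_nambu[of x y] scale_right_distrib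
            numeral_3_eq_3 del: higher_bracket.simps)
    qed
  qed simp
qed

theorem corollary4p7:
  fixes scale :: "'k::field_char_0 \<Rightarrow> 'a::ab_group_add \<Rightarrow> 'a"
    and \<mu> :: "'a \<Rightarrow> 'a \<Rightarrow> 'a" and \<alpha> :: "'a \<Rightarrow> 'a"
  assumes "multiplicative_hom_alternative_algebra scale \<mu> \<alpha>"
  shows "\<forall>k. multiplicative_nary_hom_nambu_algebra scale (2 ^ (k + 1) + 1)
           (higher_bracket scale \<mu> \<alpha> k) (\<alpha> ^^ (2 ^ (k + 1)))"
proof
  fix k
  interpret hom_alternative_char_0 scale \<mu> \<alpha>
    using assms by (simp add: hom_alternative_char_0_def)
  show "multiplicative_nary_hom_nambu_algebra scale (2 ^ (k + 1) + 1)
          (higher_bracket scale \<mu> \<alpha> k) (\<alpha> ^^ (2 ^ (k + 1)))"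
  proof (induction k)
    case 0
    have "\<alpha> ^^ 2 = \<alpha> \<circ> \<alpha>" by (simp add: numeral_2_eq_2)
    then show ?case
      using ternary_hom_nambu by (simp add: o_def del: higher_bracket.simps)
  next
    case (Suc k)
    have "higher_bracket scale \<mu> \<alpha> (Suc k) = (\<lambda>xs. higher_bracket scale \<mu> \<alpha> k
        (higher_bracket scale \<mu> \<alpha> k (take (2 ^ (k + 1) + 1) xs)
          # map (\<alpha> ^^ (2 ^ (k + 1))) (drop (2 ^ (k + 1) + 1) xs)))"
      by (rule ext) simp
    moreover have "\<alpha> ^^ (2 ^ (Suc k + 1)) = \<alpha> ^^ (2 ^ (k + 1)) \<circ> \<alpha> ^^ (2 ^ (k + 1))"
      by (simp add: mult_2 flip: funpow_add)
    moreover have "2 ^ (Suc k + 1) + 1 = 2 * (2 ^ (k + 1) + 1) - (1::nat)" by simp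
    ultimately show ?case
      using multiplicative_nary_hom_nambu_algebra_double[OF Suc] by (simp only:)
  qed
qed

end
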